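(* Let $p$ be a prime and let $a$ be a positive integer. Then $\tau_{p^a,\,p^{(a-1)p+2}} = 2p^a$.
   Context: For positive integers $m,n$, the discrete torus is $T_{m\times n} := \{0,\ldots,m-1\}\times\{0,\ldots,n-1\}\subset\mathbb{Z}^2$, and $\pi_{m,n}:\mathbb{Z}^2\to T_{m\times n}$ is the map $(x,y)\mapsto (x \bmod m,\ y \bmod n)$. A line in $\mathbb{Z}^2$ is a set $\ell_{\mathbb{R}^2}\cap\mathbb{Z}^2$, where $\ell_{\mathbb{R}^2}$ is a line in $\mathbb{R}^2$ containing at least two points with integer coordinates (equivalently, a set $\{A+k(u,v): k\in\mathbb{Z}\}$ with $A\in\mathbb{Z}^2$, $u,v \in \mathbb{Z}$, $\gcd(u,v)=1$). A line on $T_{m\times n}$ is the image under $\pi_{m,n}$ of a line in $\mathbb{Z}^2$. Points of $T_{m\times n}$ are collinear if some line on $T_{m\times n}$ contains all of them. $\tau_{m,n}$ denotes the maximal number of points that can be placed on $T_{m\times n}$ so that no three (distinct) of these points are collinear. *)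

theory Defs
  imports "HOL-Analysis.Analysis" "HOL-Computational_Algebra.Primes"
begin

definition lattice_line :: "(int \<times> int) set \<Rightarrow> bool" where
  "lattice_line l \<longleftrightarrow>
    (\<exists>L :: (real \<times> real) set. affine L \<and> aff_dim L = 1 \<and>
       l = {(x, y). (real_of_int x, real_of_int y) \<in> L}) \<and>
    (\<exists>P\<in>l. \<exists>Q\<in>l. P \<noteq> Q)"

definition torus :: "nat \<Rightarrow> nat \<Rightarrow> (int \<times> int) set" where
  "torus m n = {0..<int m} \<times> {0..<int n}"

definition torus_proj :: "nat \<Rightarrow> nat \<Rightarrow> int \<times> int \<Rightarrow> int \<times> int" where
  "torus_proj m n = (\<lambda>(x, y). (x mod int m, y mod int n))"

definition torus_line :: "nat \<Rightarrow> nat \<Rightarrow> (int \<times> int) set \<Rightarrow> bool" where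
  "torus_line m n k \<longleftrightarrow> (\<exists>l. lattice_line l \<and> k = torus_proj m n ` l)"

definition torus_collinear :: "nat \<Rightarrow> nat \<Rightarrow> (int \<times> int) set \<Rightarrow> bool" where
  "torus_collinear m n S \<longleftrightarrow> (\<exists>k. torus_line m n k \<and> S \<subseteq> k)"

definition no_three_in_line :: "nat \<Rightarrow> nat \<Rightarrow> (int \<times> int) set \<Rightarrow> bool" where
  "no_three_in_line m n S \<longleftrightarrow>
    (\<forall>A\<in>S. \<forall>B\<in>S. \<forall>C\<in>S. A \<noteq> B \<and> B \<noteq> C \<and> A \<noteq> C \<longrightarrow> \<not> torus_collinear m n {A, B, C})"

(* For positive m and n the set below is finite and contains 0, so Max is a genuine maximum. *)
definition tau :: "nat \<Rightarrow> nat \<Rightarrow> nat" where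
  "tau m n = Max (card ` {S. S \<subseteq> torus m n \<and> no_three_in_line m n S})"

lemma finite_no_three_in_line_cards:
  "finite (card ` {S. S \<subseteq> torus m n \<and> no_three_in_line m n S})"
proof -
  have "finite (torus m n)" by (simp add: torus_def)
  then have "finite {S. S \<subseteq> torus m n \<and> no_three_in_line m n S}"
    by (rule rev_finite_subset[OF finite_Pow_iff[THEN iffD2]]) auto
  then show ?thesis by simp
qed

lemma zero_in_no_three_in_line_cards:
  "0 \<in> card ` {S. S \<subseteq> torus m n \<and> no_three_in_line m n S}"
  by (rule image_eqI[of _ _ "{}"]) (auto simp: no_three_in_line_def)

lemma lattice_line_hull:
  assumes "x0 \<noteq> x1 \<or> y0 \<noteq> y1"
    and "l = {(x, y). (real_of_int x, real_of_int y) \<in>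
           affine hull {(real_of_int x0, real_of_int y0), (real_of_int x1, real_of_int y1)}}"
  shows "lattice_line l"
proof -
  let ?A = "(real_of_int x0, real_of_int y0)" and ?B = "(real_of_int x1, real_of_int y1)"
  have "?A \<noteq> ?B" using assms(1) by auto
  then have "aff_dim (affine hull {?A, ?B}) = 1"
    by (simp add: aff_dim_2)
  moreover have "(x0, y0) \<in> l" "(x1, y1) \<in> l"
    unfolding assms(2) by (simp_all add: hull_inc)
  moreover have "(x0, y0) \<noteq> (x1, y1)" using assms(1) by auto
  ultimately show ?thesis
    unfolding lattice_line_def
    by (intro conjI exI[of _ "affine hull {?A, ?B}"] bexI[of _ "(x0, y0)"] bexI[of _ "(x1, y1)"]
        affine_affine_hull assms(2))
qed

lemma in_hull_iff:
  fixes x y x0 y0 u v g :: int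
  assumes "coprime u v" "g \<noteq> 0"
  shows "(real_of_int x, real_of_int y) \<in>
     affine hull {(real_of_int x0, real_of_int y0),
       (real_of_int (x0 + g * u), real_of_int (y0 + g * v))}
     \<longleftrightarrow> (\<exists>k. x = x0 + k * u \<and> y = y0 + k * v)"
    (is "?P \<in> affine hull {?A, ?B} \<longleftrightarrow> ?R")
proof
  assume "?P \<in> affine hull {?A, ?B}"
  then obtain s t where st: "s + t = 1" "?P = s *\<^sub>R ?A + t *\<^sub>R ?B"
    unfolding affine_hull_2 by blast
  define r where "r = t * real_of_int g"
  have s: "s = 1 - t" using st(1) by simp
  have rx: "real_of_int (x - x0) = r * real_of_int u"
    and ry: "real_of_int (y - y0) = r * real_of_int v"
    using st(2) unfolding s r_def by (auto simp: algebra_simps)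
  obtain b c where bc: "b * u + c * v = 1"
    using assms(1) by (metis bezout_int coprime_imp_gcd_eq_1)
  define k where "k = b * (x - x0) + c * (y - y0)"
  have "real_of_int k = b * (r * u) + c * (r * v)"
    unfolding k_def using rx ry by simp
  also have "\<dots> = r * real_of_int (b * u + c * v)" by (simp add: algebra_simps)
  finally have k: "real_of_int k = r" using bc by simp
  have "real_of_int (x - x0) = real_of_int (k * u)"
    "real_of_int (y - y0) = real_of_int (k * v)"
    using rx ry k by simp_all
  then have "x - x0 = k * u" "y - y0 = k * v" by (simp_all only: of_int_eq_iff)
  then show ?R by (intro exI[of _ k]) auto
next
  assume ?R
  then obtain k where k: "x = x0 + k * u" "y = y0 + k * v" by blast
  define t where "t = real_of_int k / real_of_int g"
  have tg: "t * real_of_int g = real_of_int k" using assms(2) by (simp add: t_def)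
  have "x = (1 - t) * x0 + t * real_of_int (x0 + g * u)"
    "y = (1 - t) * y0 + t * real_of_int (y0 + g * v)"
    unfolding k tg[symmetric] of_int_add of_int_mult by (simp_all add: algebra_simps)
  then have "?P = (1 - t) *\<^sub>R ?A + t *\<^sub>R ?B" by simp
  moreover have "(1 - t) + t = 1" by simp
  ultimately show "?P \<in> affine hull {?A, ?B}"
    unfolding affine_hull_2 by blast
qed

lemma lattice_line_iff:
  "lattice_line l \<longleftrightarrow>
    (\<exists>x0 y0 u v. coprime u v \<and> l = range (\<lambda>k. (x0 + k * u, y0 + k * v)))"
proof
  assume "lattice_line l"
  then obtain L x0 y0 x1 y1 where L: "affine L" "aff_dim L = 1"
      "l = {(x, y). (real_of_int x, real_of_int y) \<in> L}"
    and P: "(x0, y0) \<in> l" "(x1, y1) \<in> l" "(x0, y0) \<noteq> (x1, y1)"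
    unfolding lattice_line_def by fast
  define g where "g = gcd (x1 - x0) (y1 - y0)"
  have g: "g \<noteq> 0" using P(3) by (auto simp: g_def)
  obtain u v where uv: "x1 - x0 = u * g" "y1 - y0 = v * g" "coprime u v"
    using gcd_coprime_exists[OF g[unfolded g_def]] unfolding g_def by blast
  let ?A = "(real_of_int x0, real_of_int y0)" and ?B = "(real_of_int x1, real_of_int y1)"
  have AB: "?A \<noteq> ?B" using P(3) by auto
  have "affine hull {?A, ?B} \<subseteq> L"
    using P L by (intro hull_minimal) auto
  moreover have "aff_dim (affine hull {?A, ?B}) = 1" using AB by (simp add: aff_dim_2)
  ultimately have hull: "affine hull {?A, ?B} = L"
    using L by (intro affine_dim_equal) (auto simp: affine_affine_hull)
  have eq: "x1 = x0 + g * u" "y1 = y0 + g * v"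
    using uv(1,2) by (simp_all add: algebra_simps)
  have "l = {(x, y). \<exists>k. x = x0 + k * u \<and> y = y0 + k * v}"
    unfolding L(3) hull[symmetric] eq using in_hull_iff[OF uv(3) g] by simp
  also have "\<dots> = range (\<lambda>k. (x0 + k * u, y0 + k * v))" by auto
  finally show "\<exists>x0 y0 u v. coprime u v \<and> l = range (\<lambda>k. (x0 + k * u, y0 + k * v))"
    using uv(3) by (intro exI conjI)
next
  assume "\<exists>x0 y0 u v. coprime u v \<and> l = range (\<lambda>k. (x0 + k * u, y0 + k * v))"
  then obtain x0 y0 u v where uv: "coprime u v"
    and l: "l = range (\<lambda>k. (x0 + k * u, y0 + k * v))" by blast
  show "lattice_line l"
  proof (rule lattice_line_hull)
    show "x0 \<noteq> x0 + 1 * u \<or> y0 \<noteq> y0 + 1 * v" using uv by auto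
    show "l = {(x, y). (real_of_int x, real_of_int y) \<in> affine hull
        {(real_of_int x0, real_of_int y0), (real_of_int (x0 + 1 * u), real_of_int (y0 + 1 * v))}}"
      unfolding in_hull_iff[OF uv one_neq_zero] l by auto
  qed
qed

end

theory Submission
  imports Defs "HOL-Number_Theory.Cong"
begin

text \<open>
  Every column of the torus is a line, which gives the upper bound. For the lower bound let
  \<open>F (\<Sum> x\<^sub>i p\<^sup>i) = \<Sum> x\<^sub>i\<^sup>2 p\<^bsup>p i\<^esup>\<close> in terms of base-\<open>p\<close> digits, and place in column \<open>x\<close> the two points
  of height \<open>p F x\<close> and \<open>p F x + 1\<close>. A collinear triple has integer lifts whose determinant is zero.
  If the three points have the same constant term, then at the first digit where their abscissas
  are not all equal either the three digits are distinct, and the determinant is a Vandermonde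
  determinant modulo \<open>p\<close>, or exactly two of them coincide, and the two terms of the
  determinant have different \<open>p\<close>-adic valuations because \<open>F\<close> multiplies the valuation of differences
  by about \<open>p\<close>. The valuations also differ if the constant terms are not all the same.
\<close>

section \<open>The digit-square function and its \<open>p\<close>-adic behaviour\<close>

text \<open>Taking any integer as argument lets lifts be inserted without reduction. Only the lowest
  \<open>a\<close> base-\<open>p\<close> digits enter, and floor division keeps this true for
  negative lifts.\<close>

primrec digit_squares :: "nat \<Rightarrow> nat \<Rightarrow> int \<Rightarrow> int" where
  "digit_squares p 0 x = 0"
| "digit_squares p (Suc a) x = (x mod int p)\<^sup>2 + int p ^ p * digit_squares p a (x div int p)"

lemma cong_div_power:
  fixes x y q :: int
  assumes "q > 0" and "[x = y] (mod q ^ Suc e)"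
  shows "[x div q = y div q] (mod q ^ e)" and "x mod q = y mod q"
proof -
  have "q dvd q ^ Suc e" by simp
  with assms(2) show r: "x mod q = y mod q"
    by (metis cong_def cong_dvd_modulus)
  have "x - y = q * (x div q - y div q)"
    using r by (metis add_diff_cancel_right mult_div_mod_eq right_diff_distrib')
  then have "q * q ^ e dvd q * (x div q - y div q)"
    using assms(2) by (simp add: cong_iff_dvd_diff)
  then show "[x div q = y div q] (mod q ^ e)"
    using assms(1) by (simp add: cong_iff_dvd_diff)
qed

text \<open>Arguments agreeing in their lowest \<open>e\<close> digits share the first
  \<open>e\<close> terms of the sum, and all later terms are multiples of
  \<open>p ^ (e * p)\<close>.\<close>

lemma digit_squares_cong:
  assumes "p > 0" and "e \<le> a" and "[x = y] (mod int p ^ e)"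
  shows "[digit_squares p a x = digit_squares p a y] (mod int p ^ (e * p))"
  using assms(2,3)
proof (induction a arbitrary: e x y)
  case 0
  then show ?case by simp
next
  case (Suc a)
  show ?case
  proof (cases e)
    case 0
    then show ?thesis by simp
  next
    case (Suc e')
    have c: "[x = y] (mod int p ^ Suc e')" using Suc.prems Suc by simp
    note d = cong_div_power[OF _ c]
    have "[digit_squares p a (x div int p) = digit_squares p a (y div int p)] (mod int p ^ (e' * p))"
      using Suc.IH Suc.prems Suc d(1) assms(1) by simp
    then have "[int p ^ p * digit_squares p a (x div int p) = int p ^ p * digit_squares p a (y div int p)]
        (mod int p ^ (e * p))"
      unfolding Suc using assms(1)
      by (simp add: power_add cong_iff_dvd_diff flip: right_diff_distrib)
    then show ?thesis using d(2) assms(1) by (simp add: cong_add)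
  qed
qed

lemma digit_squares_cong_mod:
  "[digit_squares p (Suc a) x = (x mod int p)\<^sup>2] (mod int p ^ p)"
  by (simp add: cong_iff_dvd_diff)

text \<open>A nonzero difference of two squared digits has size at most \<open>(p - 1)^2\<close>,
  which is below \<open>p ^ (p - 1)\<close>. This limits the valuation of the height difference of
  two points with different lowest digits.\<close>

lemma not_dvd_diff_squares:
  fixes r s :: int
  assumes "p \<ge> 2" "0 \<le> r" "r < int p" "0 \<le> s" "s < int p" "r \<noteq> s"
  shows "\<not> int p ^ (p - 1) dvd r\<^sup>2 - s\<^sup>2"
proof
  assume d: "int p ^ (p - 1) dvd r\<^sup>2 - s\<^sup>2"
  have r: "0 \<le> r\<^sup>2" "r\<^sup>2 \<le> (int p - 1)\<^sup>2" "0 \<le> s\<^sup>2" "s\<^sup>2 \<le> (int p - 1)\<^sup>2"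
    using assms by (auto intro!: power_mono)
  have "(int p - 1)\<^sup>2 < int p ^ (p - 1)"
  \<comment> \<open>For \<open>p = 2\<close> the exponent \<open>p - 1\<close> is 1, so the
    comparison through \<open>p ^ 2\<close> fails, but the claim is just
    \<open>1 < 2\<close>.\<close>
  proof (cases "p = 2")
    case False
    then have "(int p - 1)\<^sup>2 < int p ^ 2" using assms by (intro power_strict_mono) auto
    also have "\<dots> \<le> int p ^ (p - 1)" using False assms by (intro power_increasing) auto
    finally show ?thesis .
  qed simp
  then have "\<bar>r\<^sup>2 - s\<^sup>2\<bar> < int p ^ (p - 1)" using r by linarith
  moreover have "r\<^sup>2 - s\<^sup>2 \<noteq> 0" using assms by simp
  ultimately show False using dvd_imp_le_int[OF _ d] by linarith
qed

lemma prime_power_decompose: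
  fixes q x :: int
  assumes "prime q" "\<not> q ^ a dvd x"
  obtains e w where "x = q ^ e * w" "\<not> q dvd w" "e < a"
proof -
  have "x \<noteq> 0" using assms(2) by auto
  then obtain w where w: "x = q ^ multiplicity q x * w" "\<not> q dvd w"
    using assms(1) multiplicity_decompose'[of x q] by (metis not_prime_unit)
  have "multiplicity q x < a"
    using assms(2) w(1) by (metis dvd_triv_left le_imp_power_dvd dvd_trans not_less)
  with w that show thesis by blast
qed

section \<open>Three points over one graph\<close>

text \<open>If \<open>e\<close> is the valuation of \<open>x 3 - x 1\<close>, then
  \<open>y 3 - y 1\<close> is divisible by \<open>p ^ (e * p)\<close>. A zero determinant would pass
  \<open>e * (p - 1)\<close> of these factors on to \<open>y 2 - y 1\<close>, too many for a
  difference of distinct squared digits.\<close>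

lemma graph_not_collinear_two_residues:
  assumes p: "prime p"
    and y: "\<And>i. i \<in> {1,2,3::nat} \<Longrightarrow> [y i = digit_squares p (Suc a) (x i)] (mod int p ^ (a * p + 1))"
    and x: "[x 1 = x 3] (mod int p)" "\<not> [x 1 = x 2] (mod int p)"
      "\<not> [x 1 = x 3] (mod int p ^ Suc a)"
  shows "(x 2 - x 1) * (y 3 - y 1) \<noteq> (x 3 - x 1) * (y 2 - y 1)"
proof
  let ?q = "int p" and ?F = "digit_squares p (Suc a)"
  assume eq: "(x 2 - x 1) * (y 3 - y 1) = (x 3 - x 1) * (y 2 - y 1)"
  have q: "prime ?q" and p2: "p \<ge> 2" using p prime_ge_2_nat by auto
  have "\<not> ?q ^ Suc a dvd x 3 - x 1"
    using x(3) by (simp add: cong_iff_dvd_diff dvd_diff_commute)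
  then obtain e w where e: "x 3 - x 1 = ?q ^ e * w" "\<not> ?q dvd w" "e < Suc a"
    using prime_power_decompose[OF q] by blast
  \<comment> \<open>Points 1 and 3 share their lowest digit. Positivity of \<open>e\<close> later
    gives \<open>p - 1 \<le> e * (p - 1)\<close>.\<close>
  have e0: "e > 0" using x(1) e(1,2) by (cases e) (auto simp: cong_iff_dvd_diff dvd_diff_commute)
  have "[y 3 = y 1] (mod ?q ^ (e * p))"
  proof -
    have "[?F (x 3) = ?F (x 1)] (mod ?q ^ (e * p))"
      using e p2 by (intro digit_squares_cong) (auto simp: cong_iff_dvd_diff)
    moreover have "e * p \<le> a * p + 1" using mult_le_mono1[of e a p] e(3) by linarith
    then have "?q ^ (e * p) dvd ?q ^ (a * p + 1)" by (rule le_imp_power_dvd)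
    then have "[y 3 = ?F (x 3)] (mod ?q ^ (e * p))" "[y 1 = ?F (x 1)] (mod ?q ^ (e * p))"
      using y cong_dvd_modulus by blast+
    ultimately show ?thesis by (meson cong_sym cong_trans)
  qed
  then have "?q ^ (e * p) dvd ?q ^ e * (w * (y 2 - y 1))"
    using eq e(1) by (metis cong_iff_dvd_diff dvd_mult mult.assoc)
  moreover have "e * p = e + e * (p - 1)" using p2 by (cases p) auto
  ultimately have "?q ^ (e * (p - 1)) dvd w * (y 2 - y 1)"
    using p2 by (simp add: power_add)
  moreover have "coprime (?q ^ (e * (p - 1))) w"
    using q e(2) by (simp add: prime_imp_coprime)
  ultimately have "?q ^ (e * (p - 1)) dvd y 2 - y 1" using coprime_dvd_mult_right_iff by blast
  moreover have "p - 1 \<le> e * (p - 1)" using e0 by simp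
  ultimately have d: "[y 2 = y 1] (mod ?q ^ (p - 1))"
    by (meson cong_iff_dvd_diff dvd_trans le_imp_power_dvd)
  have r: "[y i = (x i mod ?q)\<^sup>2] (mod ?q ^ (p - 1))" if "i \<in> {1,2,3}" for i
  proof -
    \<comment> \<open>From \<open>0 < e < Suc a\<close>; the modulus of the hypothesis on
      \<open>y\<close> is then large enough to read heights modulo
      \<open>p ^ (p - 1)\<close>.\<close>
    have "a > 0" using e(3) e0 by linarith
    then have "p - 1 \<le> a * p + 1" by (cases a) auto
    then have "[y i = ?F (x i)] (mod ?q ^ (p - 1))"
      using y[OF that] by (meson cong_dvd_modulus le_imp_power_dvd)
    moreover have "[?F (x i) = (x i mod ?q)\<^sup>2] (mod ?q ^ (p - 1))"
      using digit_squares_cong_mod by (rule cong_dvd_modulus) (simp add: le_imp_power_dvd)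
    ultimately show ?thesis by (rule cong_trans)
  qed
  have "[(x 2 mod ?q)\<^sup>2 = (x 1 mod ?q)\<^sup>2] (mod ?q ^ (p - 1))"
    using r[of 1] r[of 2] d by (simp, meson cong_sym cong_trans)
  moreover have "x 2 mod ?q \<noteq> x 1 mod ?q" using x(2) by (simp add: cong_def)
  ultimately show False
    using not_dvd_diff_squares[OF p2, of "x 2 mod ?q" "x 1 mod ?q"] p2
    by (simp add: cong_iff_dvd_diff)
qed

text \<open>Modulo \<open>q\<close> the points lie on the parabola of squares, so the determinant is
  a product of three differences of abscissas, none divisible by \<open>q\<close>.\<close>

lemma vandermonde_not_collinear:
  fixes q :: int
  assumes q: "prime q"
    and y: "[y1 = (x1 mod q)\<^sup>2] (mod q)" "[y2 = (x2 mod q)\<^sup>2] (mod q)" "[y3 = (x3 mod q)\<^sup>2] (mod q)"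
    and x: "\<not> [x1 = x2] (mod q)" "\<not> [x1 = x3] (mod q)" "\<not> [x2 = x3] (mod q)"
  shows "(x2 - x1) * (y3 - y1) \<noteq> (x3 - x1) * (y2 - y1)"
proof
  assume eq: "(x2 - x1) * (y3 - y1) = (x3 - x1) * (y2 - y1)"
  have sq: "[y1 = x1\<^sup>2] (mod q)" "[y2 = x2\<^sup>2] (mod q)" "[y3 = x3\<^sup>2] (mod q)"
    using y by (simp_all add: cong_def power_mod)
  have "[(x2 - x1) * (y3 - y1) - (x3 - x1) * (y2 - y1) =
      (x2 - x1) * (x3\<^sup>2 - x1\<^sup>2) - (x3 - x1) * (x2\<^sup>2 - x1\<^sup>2)] (mod q)"
    using sq by (intro cong_diff cong_mult cong_refl)
  also have "(x2 - x1) * (x3\<^sup>2 - x1\<^sup>2) - (x3 - x1) * (x2\<^sup>2 - x1\<^sup>2) = (x1 - x2) * (x1 - x3) * (x3 - x2)"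
    by algebra
  finally have "q dvd (x1 - x2) * (x1 - x3) * (x3 - x2)"
    using eq by (simp add: cong_iff_dvd_diff)
  then show False
    using x q by (auto simp: prime_dvd_mult_iff cong_iff_dvd_diff dvd_diff_commute)
qed

text \<open>Induction strips a lowest digit common to all three points: this scales the determinant
  by \<open>p ^ (p + 1)\<close> and lowers the exponent of the modulus by \<open>p\<close>, leaving
  exponent 1 when one digit remains. Heights are given only up to congruence because they are
  lifts.\<close>

lemma graph_not_collinear:
  assumes p: "prime p"
    and "\<And>i. i \<in> {1,2,3::nat} \<Longrightarrow> [y i = digit_squares p (Suc a) (x i)] (mod int p ^ (a * p + 1))"
    and "\<not> [x 1 = x 2] (mod int p ^ Suc a)" "\<not> [x 1 = x 3] (mod int p ^ Suc a)"
      "\<not> [x 2 = x 3] (mod int p ^ Suc a)"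
  shows "(x 2 - x 1) * (y 3 - y 1) \<noteq> (x 3 - x 1) * (y 2 - y 1)"
  using assms(2-)
proof (induction a arbitrary: x y)
  let ?q = "int p"
  have q: "prime ?q" using p by simp
  case 0
  have "[y i = (x i mod ?q)\<^sup>2] (mod ?q)" if "i \<in> {1,2,3}" for i
    using 0(1)[OF that] by simp
  then show ?case using 0(2-) q by (intro vandermonde_not_collinear[of ?q]) auto
next
  let ?q = "int p"
  have q: "prime ?q" and p2: "p \<ge> 2" using p prime_ge_2_nat by auto
  case (Suc a)
  consider (same) "[x 1 = x 2] (mod ?q)" "[x 1 = x 3] (mod ?q)"
    | (a) "[x 1 = x 3] (mod ?q)" "\<not> [x 1 = x 2] (mod ?q)"
    | (b) "[x 1 = x 2] (mod ?q)" "\<not> [x 1 = x 3] (mod ?q)"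
    | (c) "[x 2 = x 3] (mod ?q)" "\<not> [x 2 = x 1] (mod ?q)"
    | (distinct) "\<not> [x 1 = x 2] (mod ?q)" "\<not> [x 1 = x 3] (mod ?q)" "\<not> [x 2 = x 3] (mod ?q)"
    using cong_sym by blast
  then show ?case
  proof cases
    case same
    define r where "r = x 1 mod ?q"
    have xr: "x i = r + ?q * (x i div ?q)" "x i mod ?q = r" if "i \<in> {1,2,3}" for i
    proof -
      show "x i mod ?q = r" using same that by (auto simp: r_def cong_def)
      then show "x i = r + ?q * (x i div ?q)" by (metis mod_mult_div_eq)
    qed
    \<comment> \<open>The heights over the remaining digits: the common term
      \<open>r\<^sup>2\<close> is removed and the weight \<open>?q ^ p\<close> of the next digit
      divided out.\<close>
    define z where "z i = (y i - r\<^sup>2) div ?q ^ p" for i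
    have z: "y i = r\<^sup>2 + ?q ^ p * z i"
        "[z i = digit_squares p (Suc a) (x i div ?q)] (mod ?q ^ (a * p + 1))" if "i \<in> {1,2,3}" for i
    proof -
      let ?G = "digit_squares p (Suc a) (x i div ?q)"
      have "digit_squares p (Suc (Suc a)) (x i) = r\<^sup>2 + ?q ^ p * ?G"
        by (simp only: digit_squares.simps(2)[of p "Suc a"] xr(2)[OF that])
      moreover have pw: "?q ^ (Suc a * p + 1) = ?q ^ p * ?q ^ (a * p + 1)" by (simp add: power_add)
      ultimately have c: "?q ^ p * ?q ^ (a * p + 1) dvd y i - r\<^sup>2 - ?q ^ p * ?G"
        using Suc.prems(1)[OF that] by (simp only: cong_iff_dvd_diff diff_diff_eq)
      then have "?q ^ p dvd y i - r\<^sup>2 - ?q ^ p * ?G" by (rule dvd_mult_left)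
      then have "?q ^ p dvd y i - r\<^sup>2"
        by (metis diff_add_cancel dvd_add dvd_triv_left)
      then have *: "y i - r\<^sup>2 = ?q ^ p * z i" by (simp only: z_def dvd_mult_div_cancel)
      then show "y i = r\<^sup>2 + ?q ^ p * z i" by simp
      have "?q ^ p * ?q ^ (a * p + 1) dvd ?q ^ p * (z i - ?G)"
        using c * by (simp only: right_diff_distrib)
      then show "[z i = ?G] (mod ?q ^ (a * p + 1))"
        using p2 by (simp add: cong_iff_dvd_diff)
    qed
    have ne: "\<not> [x i div ?q = x j div ?q] (mod ?q ^ Suc a)"
      if "i \<in> {1,2,3}" "j \<in> {1,2,3}" "\<not> [x i = x j] (mod ?q ^ Suc (Suc a))" for i j
    proof
      assume "[x i div ?q = x j div ?q] (mod ?q ^ Suc a)"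
      then have "?q * ?q ^ Suc a dvd ?q * (x i div ?q - x j div ?q)"
        by (simp only: cong_iff_dvd_diff mult_dvd_mono dvd_refl)
      moreover have "x i - x j = ?q * (x i div ?q - x j div ?q)"
        using xr(1)[OF that(1)] xr(1)[OF that(2)] by (simp only: right_diff_distrib)
      ultimately show False using that(3) by (simp add: cong_iff_dvd_diff)
    qed
    let ?x = "\<lambda>i. x i div ?q"
    have IH: "(?x 2 - ?x 1) * (z 3 - z 1) \<noteq> (?x 3 - ?x 1) * (z 2 - z 1)"
      using Suc.prems(2-4) by (intro Suc.IH[of z ?x] z(2) ne) auto
    have dx: "x i - x 1 = ?q * (?x i - ?x 1)" and dy: "y i - y 1 = ?q ^ p * (z i - z 1)"
      if "i \<in> {1,2,3}" for i
      using xr(1)[OF that] xr(1)[of 1] z(1)[OF that] z(1)[of 1]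
      by (simp_all add: right_diff_distrib)
    have "(x 2 - x 1) * (y 3 - y 1) = (?q * ?q ^ p) * ((?x 2 - ?x 1) * (z 3 - z 1))"
      using dx[of 2] dy[of 3] by simp
    moreover have "(x 3 - x 1) * (y 2 - y 1) = (?q * ?q ^ p) * ((?x 3 - ?x 1) * (z 2 - z 1))"
      using dx[of 3] dy[of 2] by simp
    ultimately show ?thesis using IH p2 by simp
  next
    case a
    then show ?thesis
      using Suc.prems by (intro graph_not_collinear_two_residues[OF p, of y "Suc a" x])
  next
    case b
    \<comment> \<open>Relabelling makes the coinciding pair the points 1 and 3; the determinant only
      changes sign.\<close>
    define s :: "nat \<Rightarrow> nat" where "s = id(2 := 3, 3 := 2)"
    have "(x (s 2) - x (s 1)) * (y (s 3) - y (s 1)) \<noteq> (x (s 3) - x (s 1)) * (y (s 2) - y (s 1))"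
      using b Suc.prems
      by (intro graph_not_collinear_two_residues[OF p, of "y \<circ> s" "Suc a" "x \<circ> s", unfolded o_def])
        (auto simp: s_def)
    then show ?thesis by (simp add: s_def)
  next
    case c
    define s :: "nat \<Rightarrow> nat" where "s = id(1 := 2, 2 := 1)"
    have "(x (s 2) - x (s 1)) * (y (s 3) - y (s 1)) \<noteq> (x (s 3) - x (s 1)) * (y (s 2) - y (s 1))"
      using c Suc.prems
      by (intro graph_not_collinear_two_residues[OF p, of "y \<circ> s" "Suc a" "x \<circ> s", unfolded o_def])
        (auto simp: s_def)
    then show ?thesis by (simp add: s_def algebra_simps)
  next
    case distinct
    have "[y i = (x i mod ?q)\<^sup>2] (mod ?q)" if "i \<in> {1,2,3}" for i
    proof -
      have "?q dvd ?q ^ (Suc a * p + 1)" "?q dvd ?q ^ p" using p2 by auto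
      then show ?thesis
        using Suc.prems(1)[OF that] digit_squares_cong_mod[of p "Suc a" "x i"]
        by (meson cong_dvd_modulus cong_trans)
    qed
    then show ?thesis using distinct q by (intro vandermonde_not_collinear[of ?q]) auto
  qed
qed

section \<open>Points with equal or different constant terms\<close>

text \<open>Subtracting \<open>c\<close> and dividing heights by \<open>p\<close> reduces to the
  graph itself. The division costs one power of \<open>p\<close>, whence the exponent
  \<open>a * p + 2\<close>.\<close>

lemma shifted_graph_not_collinear:
  assumes p: "prime p"
    and y: "\<And>i. i \<in> {1,2,3::nat} \<Longrightarrow>
      [y i = int p * digit_squares p (Suc a) (x i) + c] (mod int p ^ (a * p + 2))"
    and x: "\<not> [x 1 = x 2] (mod int p ^ Suc a)" "\<not> [x 1 = x 3] (mod int p ^ Suc a)"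
      "\<not> [x 2 = x 3] (mod int p ^ Suc a)"
  shows "(x 2 - x 1) * (y 3 - y 1) \<noteq> (x 3 - x 1) * (y 2 - y 1)"
proof -
  let ?q = "int p" and ?F = "digit_squares p (Suc a)"
  have p0: "?q \<noteq> 0" using p by auto
  define z where "z i = (y i - c) div ?q" for i
  have z: "y i - c = ?q * z i" "[z i = ?F (x i)] (mod ?q ^ (a * p + 1))" if "i \<in> {1,2,3}" for i
  proof -
    have d: "?q * ?q ^ (a * p + 1) dvd y i - c - ?q * ?F (x i)"
      using y[OF that] by (simp add: cong_iff_dvd_diff algebra_simps)
    then have "?q dvd y i - c - ?q * ?F (x i)" by (rule dvd_mult_left)
    then have "?q dvd y i - c" by (metis diff_add_cancel dvd_add dvd_triv_left)
    then show *: "y i - c = ?q * z i" by (simp only: z_def dvd_mult_div_cancel)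
    have "?q * ?q ^ (a * p + 1) dvd ?q * (z i - ?F (x i))"
      using d * by (simp only: right_diff_distrib)
    then show "[z i = ?F (x i)] (mod ?q ^ (a * p + 1))"
      using p0 by (simp add: cong_iff_dvd_diff)
  qed
  have "(x 2 - x 1) * (z 3 - z 1) \<noteq> (x 3 - x 1) * (z 2 - z 1)"
    using x z(2) by (intro graph_not_collinear[OF p, of z a x])
  moreover have "y i - y 1 = ?q * (z i - z 1)" if "i \<in> {1,2,3}" for i
    using z(1)[OF that] z(1)[of 1] by (simp add: algebra_simps)
  then have "y 3 - y 1 = ?q * (z 3 - z 1)" "y 2 - y 1 = ?q * (z 2 - z 1)" by simp_all
  ultimately show ?thesis using p0 by (metis mult.left_commute mult_left_cancel)
qed

text \<open>Let \<open>e\<close> be the valuation of \<open>x2 - x1\<close>. Since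
  \<open>y3 - y1\<close> is congruent to \<open>d - c\<close> and so prime to \<open>p\<close>, the
  left product has valuation exactly \<open>e\<close>, while the right one is divisible by
  \<open>p ^ (e + 1)\<close>.\<close>

lemma mixed_not_collinear:
  assumes p: "prime p"
    and y1: "[y1 = int p * digit_squares p (Suc a) x1 + c] (mod int p ^ (a * p + 2))"
    and y2: "[y2 = int p * digit_squares p (Suc a) x2 + c] (mod int p ^ (a * p + 2))"
    and y3: "[y3 = int p * digit_squares p (Suc a) x3 + d] (mod int p ^ (a * p + 2))"
    and cd: "\<not> [c = d] (mod int p)"
    and x: "\<not> [x1 = x2] (mod int p ^ Suc a)"
  shows "(x2 - x1) * (y3 - y1) \<noteq> (x3 - x1) * (y2 - y1)"
proof
  let ?q = "int p" and ?F = "digit_squares p (Suc a)"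
  assume eq: "(x2 - x1) * (y3 - y1) = (x3 - x1) * (y2 - y1)"
  have q: "prime ?q" and p2: "p \<ge> 2" using p prime_ge_2_nat by auto
  have "\<not> ?q ^ Suc a dvd x2 - x1"
    using x by (simp add: cong_iff_dvd_diff dvd_diff_commute)
  then obtain e w where e: "x2 - x1 = ?q ^ e * w" "\<not> ?q dvd w" "e < Suc a"
    using prime_power_decompose[OF q] by blast
  have "?q ^ (e * p + 1) dvd y2 - y1"
  proof -
    have "[?F x2 = ?F x1] (mod ?q ^ (e * p))"
      using e p2 by (intro digit_squares_cong) (auto simp: cong_iff_dvd_diff)
    then have "[?q * ?F x2 + c = ?q * ?F x1 + c] (mod ?q ^ (e * p + 1))"
      by (simp add: cong_iff_dvd_diff flip: right_diff_distrib)
    moreover have "e * p + 1 \<le> a * p + 2" using mult_le_mono1[of e a p] e(3) by linarith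
    then have "?q ^ (e * p + 1) dvd ?q ^ (a * p + 2)" by (rule le_imp_power_dvd)
    ultimately have "[y2 = y1] (mod ?q ^ (e * p + 1))"
      using y1 y2 by (meson cong_dvd_modulus cong_sym cong_trans)
    then show ?thesis by (simp add: cong_iff_dvd_diff)
  qed
  \<comment> \<open>The factor \<open>p\<close> in front of the digit squares supplies the
    \<open>+ 1\<close> on the right, which is decisive when \<open>e = 0\<close>.\<close>
  moreover have "e + 1 \<le> e * p + 1" using p2 by simp
  ultimately have "?q ^ (e + 1) dvd (x3 - x1) * (y2 - y1)"
    by (meson dvd_mult dvd_trans le_imp_power_dvd)
  then have "?q ^ e * ?q dvd ?q ^ e * (w * (y3 - y1))"
    by (simp only: eq[symmetric] e(1) power_add power_one_right mult.assoc)
  then have "?q dvd w * (y3 - y1)" using p2 by simp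
  then have "[y3 = y1] (mod ?q)" using q e(2) by (simp add: prime_dvd_mult_iff cong_iff_dvd_diff)
  moreover have yc: "[y = b] (mod ?q)" if "[y = ?q * ?F u + b] (mod ?q ^ (a * p + 2))" for y u b
  proof -
    have "?q dvd ?q ^ (a * p + 2)" by simp
    then have "[y = ?q * ?F u + b] (mod ?q)" using that cong_dvd_modulus by blast
    then show ?thesis by (simp add: cong_def)
  qed
  ultimately show False
    using cd yc[OF y1] yc[OF y3] by (meson cong_sym cong_trans)
qed

section \<open>Lifting to the integers and the extremal set\<close>

text \<open>The three points have preimages on a single integer line, whose difference vectors are
  parallel.\<close>

lemma torus_collinear_lifts:
  assumes "torus_collinear m n {A, B, C}"
  obtains x y where
    "A = torus_proj m n (x (1::nat), y (1::nat))" "B = torus_proj m n (x 2, y 2)"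
    "C = torus_proj m n (x 3, y 3)"
    "(x 2 - x 1) * (y 3 - y 1) = (x 3 - x 1) * (y 2 - y 1 :: int)"
proof -
  obtain l where l: "lattice_line l" "{A, B, C} \<subseteq> torus_proj m n ` l"
    using assms by (auto simp: torus_collinear_def torus_line_def)
  obtain x0 y0 u v where uv: "l = range (\<lambda>k. (x0 + k * u, y0 + k * v))"
    using l(1) by (auto simp: lattice_line_iff)
  obtain i j k where "A = torus_proj m n (x0 + i * u, y0 + i * v)"
    "B = torus_proj m n (x0 + j * u, y0 + j * v)" "C = torus_proj m n (x0 + k * u, y0 + k * v)"
    using l(2) unfolding uv by auto
  then show thesis
    by (intro that[of "\<lambda>t. x0 + (if t = 1 then i else if t = 2 then j else k) * u"
          "\<lambda>t. y0 + (if t = 1 then i else if t = 2 then j else k) * v"])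
      (auto simp: algebra_simps)
qed

text \<open>The parameter \<open>a\<close> is one less than the exponent in the theorem, so there
  are \<open>Suc a\<close> digits. The constants 0 and 1 give the two points of a column.\<close>

definition double_graph :: "nat \<Rightarrow> nat \<Rightarrow> (int \<times> int) set" where
  "double_graph p a = (\<lambda>(x, c). (x, (int p * digit_squares p (Suc a) x + c) mod int p ^ (a * p + 2))) `
     ({0..<int p ^ Suc a} \<times> {0, 1})"

lemma double_graph_subset:
  assumes "p > 0"
  shows "double_graph p a \<subseteq> torus (p ^ Suc a) (p ^ (a * p + 2))"
proof -
  have "int p ^ (a * p + 2) > 0" using assms by simp
  then show ?thesis
    unfolding double_graph_def torus_def by (auto simp del: power_Suc)
qed

lemma card_double_graph:
  assumes "p \<ge> 2"
  shows "card (double_graph p a) = 2 * p ^ Suc a"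
proof -
  let ?q = "int p" and ?N = "int p ^ (a * p + 2)" and ?F = "digit_squares p (Suc a)"
  have "c = d" if "(?q * ?F x + c) mod ?N = (?q * ?F x + d) mod ?N" "c \<in> {0,1}" "d \<in> {0,1}" for x c d
  proof -
    have "[c = d] (mod ?N)" using that(1) by (simp only: cong_def[symmetric] cong_add_lcancel)
    moreover have "?q dvd ?N" by simp
    ultimately have "?q dvd c - d" by (meson cong_iff_dvd_diff dvd_trans)
    moreover have "\<bar>c - d\<bar> < ?q" using that assms by auto
    ultimately show ?thesis using dvd_imp_le_int[of "c - d" ?q] by linarith
  qed
  then have "inj_on (\<lambda>P. (fst P, (?q * ?F (fst P) + snd P) mod ?N)) ({0..<?q ^ Suc a} \<times> {0, 1})"
    by (intro inj_onI prod_eqI) (metis (no_types) prod.inject, metis (no_types) mem_Times_iff prod.inject)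
  then have "inj_on (\<lambda>(x, c). (x, (?q * ?F x + c) mod ?N)) ({0..<?q ^ Suc a} \<times> {0, 1})"
    by (simp only: case_prod_unfold)
  then have "card (double_graph p a) = card ({0..<?q ^ Suc a} \<times> {0, 1 :: int})"
    unfolding double_graph_def by (rule card_image)
  also have "\<dots> = card {0..<?q ^ Suc a} * 2" by (simp add: card_cartesian_product)
  also have "card {0..<?q ^ Suc a} = p ^ Suc a"
    by (simp del: power_Suc flip: of_nat_power)
  finally show ?thesis by simp
qed

text \<open>Membership evaluates the digit squares at the reduced abscissa. Passing to the lift
  \<open>x\<close> preserves them modulo \<open>p ^ (a * p + 1)\<close>, and the outer factor
  \<open>p\<close> raises this to the full modulus.\<close>

lemma double_graph_lift:
  assumes p: "p \<ge> 2" and "torus_proj (p ^ Suc a) (p ^ (a * p + 2)) (x, y) \<in> double_graph p a"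
  obtains c where "c \<in> {0, 1}"
    "[y = int p * digit_squares p (Suc a) x + c] (mod int p ^ (a * p + 2))"
proof -
  let ?q = "int p" and ?N = "int p ^ (a * p + 2)" and ?F = "digit_squares p (Suc a)"
  let ?x = "x mod ?q ^ Suc a"
  obtain c where c: "c \<in> {0, 1}" "[y = ?q * ?F ?x + c] (mod ?N)"
    using assms(2)
    by (auto simp: torus_proj_def double_graph_def cong_def simp del: digit_squares.simps power_Suc)
  have "[?F ?x = ?F x] (mod ?q ^ (Suc a * p))"
    using p by (intro digit_squares_cong) (auto simp del: power_Suc)
  moreover have "?q ^ (a * p + 1) dvd ?q ^ (Suc a * p)"
    using p by (intro le_imp_power_dvd) simp
  ultimately have "[?F ?x = ?F x] (mod ?q ^ (a * p + 1))" by (rule cong_dvd_modulus)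
  then have "?q * ?q ^ (a * p + 1) dvd ?q * (?F ?x - ?F x)"
    by (simp only: cong_iff_dvd_diff mult_dvd_mono dvd_refl)
  then have "[?q * ?F ?x + c = ?q * ?F x + c] (mod ?N)"
    by (simp add: cong_iff_dvd_diff right_diff_distrib del: digit_squares.simps)
  with c that show thesis using cong_trans by blast
qed

lemma no_three_in_line_double_graph:
  assumes p: "prime p"
  shows "no_three_in_line (p ^ Suc a) (p ^ (a * p + 2)) (double_graph p a)"
  unfolding no_three_in_line_def
proof (intro ballI impI notI)
  let ?q = "int p" and ?N = "int p ^ (a * p + 2)" and ?F = "digit_squares p (Suc a)"
  let ?pr = "torus_proj (p ^ Suc a) (p ^ (a * p + 2))"
  fix A B C
  assume S: "A \<in> double_graph p a" "B \<in> double_graph p a" "C \<in> double_graph p a"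
    and ne: "A \<noteq> B \<and> B \<noteq> C \<and> A \<noteq> C"
    and "torus_collinear (p ^ Suc a) (p ^ (a * p + 2)) {A, B, C}"
  then obtain x y where
    l: "A = ?pr (x (1::nat), y (1::nat))" "B = ?pr (x 2, y 2)" "C = ?pr (x 3, y 3)"
    and eq: "(x 2 - x 1) * (y 3 - y 1) = (x 3 - x 1) * (y 2 - y 1)"
    using torus_collinear_lifts by metis
  have p2: "p \<ge> 2" using p prime_ge_2_nat by auto
  have "\<exists>c. c \<in> {0, 1} \<and> [y i = ?q * ?F (x i) + c] (mod ?N)" if "i \<in> {1,2,3}" for i
  proof -
    have "?pr (x i, y i) \<in> double_graph p a" using that S l by auto
    then show ?thesis using double_graph_lift[OF p2] by blast
  qed
  then obtain c where c: "\<And>i. i \<in> {1,2,3} \<Longrightarrow> c i \<in> {0, 1}"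
      "\<And>i. i \<in> {1,2,3} \<Longrightarrow> [y i = ?q * ?F (x i) + c i] (mod ?N)"
    by metis
  \<comment> \<open>Lifts with the same constant and congruent abscissas project to one point, since
    \<open>a * p + 2 \<le> Suc a * p\<close>. Points with different constants may share a
    column.\<close>
  have nx: "\<not> [x i = x j] (mod ?q ^ Suc a)"
    if "i \<in> {1,2,3}" "j \<in> {1,2,3}" "c i = c j" "?pr (x i, y i) \<noteq> ?pr (x j, y j)" for i j
  proof
    assume x: "[x i = x j] (mod ?q ^ Suc a)"
    have "[?F (x i) = ?F (x j)] (mod ?q ^ (Suc a * p))"
      using p2 x by (intro digit_squares_cong) auto
    moreover have "?q ^ (a * p + 2) dvd ?q ^ (Suc a * p)"
      using p2 by (intro le_imp_power_dvd) simp
    ultimately have "[?F (x i) = ?F (x j)] (mod ?N)" by (rule cong_dvd_modulus)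
    then have "[?q * ?F (x i) + c i = ?q * ?F (x j) + c j] (mod ?N)"
      unfolding that(3) by (intro cong_add cong_mult cong_refl)
    then have "[y i = y j] (mod ?N)"
      using c(2)[OF that(1)] c(2)[OF that(2)] by (meson cong_sym cong_trans)
    then show False using that(4) x by (simp add: torus_proj_def cong_def)
  qed
  have n12: "\<not> [x 1 = x 2] (mod ?q ^ Suc a)" if "c 1 = c 2"
    by (rule nx[OF _ _ that]) (use ne l in auto)
  have n13: "\<not> [x 1 = x 3] (mod ?q ^ Suc a)" if "c 1 = c 3"
    by (rule nx[OF _ _ that]) (use ne l in auto)
  have n23: "\<not> [x 2 = x 3] (mod ?q ^ Suc a)" if "c 2 = c 3"
    by (rule nx[OF _ _ that]) (use ne l in auto)
  have ncd: "\<not> [c i = c j] (mod ?q)" if "c i \<noteq> c j" "i \<in> {1,2,3}" "j \<in> {1,2,3}" for i j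
    using c(1)[OF that(2)] c(1)[OF that(3)] that(1) p2 by (auto simp: cong_def)
  have y: "[y 1 = ?q * ?F (x 1) + c 1] (mod ?N)" "[y 2 = ?q * ?F (x 2) + c 2] (mod ?N)"
    "[y 3 = ?q * ?F (x 3) + c 3] (mod ?N)"
    by (rule c(2), simp)+
  \<comment> \<open>Two of three constants from \<open>{0, 1}\<close> agree. In the unequal cases
    the agreeing pair is passed first to \<open>mixed_not_collinear\<close>.\<close>
  consider (same) "c 1 = c 2" "c 1 = c 3" | (eq12) "c 1 = c 2" "c 1 \<noteq> c 3"
    | (eq13) "c 1 = c 3" "c 1 \<noteq> c 2" | (eq23) "c 2 = c 3" "c 2 \<noteq> c 1"
    using c(1)[of 1] c(1)[of 2] c(1)[of 3] by auto
  then show False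
  proof cases
    case same
    have "[y i = ?q * ?F (x i) + c 1] (mod ?N)" if "i \<in> {1,2,3}" for i
      using y same that by (auto simp del: digit_squares.simps)
    moreover have "c 2 = c 3" using same by simp
    ultimately show False
      using shifted_graph_not_collinear[OF p, of y a x "c 1"] n12 n13 n23 same eq by blast
  next
    case eq12
    have "\<not> [c 1 = c 3] (mod ?q)" by (rule ncd[OF eq12(2)]) simp_all
    from mixed_not_collinear[OF p y(1) y(2)[folded eq12(1)] y(3) this n12[OF eq12(1)]] eq
    show False by simp
  next
    case eq13
    have "\<not> [c 1 = c 2] (mod ?q)" by (rule ncd[OF eq13(2)]) simp_all
    from mixed_not_collinear[OF p y(1) y(3)[folded eq13(1)] y(2) this n13[OF eq13(1)]] eq
    show False by simp
  next
    case eq23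
    have "\<not> [c 2 = c 1] (mod ?q)" by (rule ncd[OF eq23(2)]) simp_all
    from mixed_not_collinear[OF p y(2) y(3)[folded eq23(1)] y(1) this n23[OF eq23(1)]] eq
    show False by (simp add: algebra_simps)
  qed
qed

section \<open>The upper bound and the value of \<open>tau\<close>\<close>

lemma card_no_three_in_line_le:
  assumes S: "S \<subseteq> torus m n" and no3: "no_three_in_line m n S"
  shows "card S \<le> 2 * m"
proof -
  let ?col = "\<lambda>x. {P \<in> S. fst P = x}"
  have col: "card (?col x) \<le> 2" for x
  proof (rule ccontr)
    assume "\<not> ?thesis"
    then have "card (?col x) \<ge> 3" by simp
    then obtain T where T: "T \<subseteq> ?col x" "card T = 3" by (meson obtain_subset_with_card_n)
    then obtain A B C where ABC: "T = {A, B, C}" "A \<noteq> B" "B \<noteq> C" "A \<noteq> C"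
      by (metis card_3_iff)
    \<comment> \<open>The direction \<open>(0, 1)\<close> is primitive, and the projection of this
      vertical line contains all torus points with abscissa \<open>x\<close>.\<close>
    have "lattice_line (range (\<lambda>k. (x + k * 0, 0 + k * 1)))"
      unfolding lattice_line_iff by (metis coprime_1_right)
    then have "torus_line m n (torus_proj m n ` range (\<lambda>k. (x + k * 0, 0 + k * 1)))"
      unfolding torus_line_def by blast
    moreover have "T \<subseteq> torus_proj m n ` range (\<lambda>k. (x + k * 0, 0 + k * 1))"
    proof
      fix P assume "P \<in> T"
      then have "P \<in> torus m n" "fst P = x" using T(1) S by auto
      then have "P = torus_proj m n (x + snd P * 0, 0 + snd P * 1)"
        by (cases P) (auto simp: torus_def torus_proj_def)
      then show "P \<in> torus_proj m n ` range (\<lambda>k. (x + k * 0, 0 + k * 1))" by blast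
    qed
    ultimately have "torus_collinear m n {A, B, C}"
      unfolding torus_collinear_def ABC(1) by blast
    then show False
      using no3 T(1) ABC unfolding no_three_in_line_def by auto
  qed
  have "S = (\<Union>x\<in>{0..<int m}. ?col x)" using S by (auto simp: torus_def)
  then have "card S = card (\<Union>x\<in>{0..<int m}. ?col x)" by (rule arg_cong)
  also have "\<dots> \<le> (\<Sum>x\<in>{0..<int m}. card (?col x))" by (rule card_UN_le) simp
  also have "\<dots> \<le> (\<Sum>x\<in>{0..<int m}. 2)" by (rule sum_mono) (rule col)
  finally show ?thesis by simp
qed

theorem theorem3:
  fixes p a :: nat
  assumes "prime p" and "a > 0"
  shows "tau (p ^ a) (p ^ ((a - 1) * p + 2)) = 2 * p ^ a"
proof -
  \<comment> \<open>Writing \<open>a\<close> as a successor removes the truncated subtraction and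
    matches the indexing of \<open>double_graph\<close>.\<close>
  obtain b where b: "a = Suc b" using assms(2) gr0_implies_Suc by blast
  have p2: "p \<ge> 2" using assms(1) by (rule prime_ge_2_nat)
  have "tau (p ^ Suc b) (p ^ (b * p + 2)) = 2 * p ^ Suc b"
    unfolding tau_def
  proof (rule Max_eqI)
    have "card (double_graph p b) \<in> card ` {S. S \<subseteq> torus (p ^ Suc b) (p ^ (b * p + 2)) \<and>
        no_three_in_line (p ^ Suc b) (p ^ (b * p + 2)) S}"
      using double_graph_subset[of p b] no_three_in_line_double_graph[OF assms(1), of b] p2
      by (intro imageI) auto
    then show "2 * p ^ Suc b \<in> card ` {S. S \<subseteq> torus (p ^ Suc b) (p ^ (b * p + 2)) \<and>
        no_three_in_line (p ^ Suc b) (p ^ (b * p + 2)) S}"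
      by (simp only: card_double_graph[OF p2])
  qed (use card_no_three_in_line_le finite_no_three_in_line_cards in auto)
  then show ?thesis by (simp add: b)
qed

end
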